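(* For every positive integer $n$ and every odd positive integer $m=2k+1$, $$N(O(2n),m)=\binom{n+[m/2]}{[m/2]}.$$
   Context: $O(N)$ is the group of real $N\times N$ orthogonal matrices. $N(G,m)$ denotes the number of conjugacy classes of $G$ (under conjugation by elements of $G$) contained in $\{x\in G: x^m=1\}$. $[\cdot]$ denotes the integer part (floor). *)

theory Defs
  imports "Jordan_Normal_Form.Matrix" "HOL-Algebra.Group_Action"
begin

(* Not the library's orthogonal_mat, which only asks for pairwise orthogonal nonzero columns. *)
definition orthogonal_group :: "nat \<Rightarrow> real mat monoid" where
  "orthogonal_group N =
    \<lparr>carrier = {A \<in> carrier_mat N N.
                  transpose_mat A * A = 1\<^sub>m N \<and> A * transpose_mat A = 1\<^sub>m N},
     monoid.mult = (*),
     one = 1\<^sub>m N\<rparr>"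

lemma group_orthogonal_group: "group (orthogonal_group N)"
proof (rule groupI)
  fix A B assume "A \<in> carrier (orthogonal_group N)" "B \<in> carrier (orthogonal_group N)"
  then have A: "A \<in> carrier_mat N N" "transpose_mat A * A = 1\<^sub>m N" "A * transpose_mat A = 1\<^sub>m N"
    and B: "B \<in> carrier_mat N N" "transpose_mat B * B = 1\<^sub>m N" "B * transpose_mat B = 1\<^sub>m N"
    by (auto simp: orthogonal_group_def)
  have T: "transpose_mat A \<in> carrier_mat N N" "transpose_mat B \<in> carrier_mat N N"
    using A(1) B(1) by auto
  have P: "A * B \<in> carrier_mat N N" "transpose_mat B * transpose_mat A \<in> carrier_mat N N"
    using A(1) B(1) T by auto
  have "(transpose_mat B * transpose_mat A) * (A * B) = transpose_mat B * ((transpose_mat A * A) * B)"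
    using A(1) B(1) T P by (simp add: assoc_mult_mat[of _ N N _ N _ N])
  then have 1: "(transpose_mat B * transpose_mat A) * (A * B) = 1\<^sub>m N"
    using A B by simp
  have "(A * B) * (transpose_mat B * transpose_mat A) = A * ((B * transpose_mat B) * transpose_mat A)"
    using A(1) B(1) T P by (simp add: assoc_mult_mat[of _ N N _ N _ N])
  then have 2: "(A * B) * (transpose_mat B * transpose_mat A) = 1\<^sub>m N"
    using A B T by simp
  show "A \<otimes>\<^bsub>orthogonal_group N\<^esub> B \<in> carrier (orthogonal_group N)"
    using 1 2 P(1) by (simp add: orthogonal_group_def transpose_mult[OF A(1) B(1)])
next
  fix A assume "A \<in> carrier (orthogonal_group N)"
  then show "\<exists>B \<in> carrier (orthogonal_group N).
      B \<otimes>\<^bsub>orthogonal_group N\<^esub> A = \<one>\<^bsub>orthogonal_group N\<^esub>"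
    by (intro bexI[of _ "transpose_mat A"]) (auto simp: orthogonal_group_def)
qed (auto simp: orthogonal_group_def assoc_mult_mat)

definition conjugacy_classes :: "('a, 'b) monoid_scheme \<Rightarrow> 'a set set" where
  "conjugacy_classes G =
    orbits G (carrier G) (\<lambda>g. \<lambda>x \<in> carrier G. g \<otimes>\<^bsub>G\<^esub> x \<otimes>\<^bsub>G\<^esub> inv\<^bsub>G\<^esub> g)"

(* card is 0 on infinite sets, so only a nonzero value determines the number of classes. *)
definition num_conjugacy_classes :: "('a, 'b) monoid_scheme \<Rightarrow> nat \<Rightarrow> nat" where
  "num_conjugacy_classes G m =
    card {C \<in> conjugacy_classes G. C \<subseteq> {x \<in> carrier G. x [^]\<^bsub>G\<^esub> m = \<one>\<^bsub>G\<^esub>}}"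

end

theory Submission
  imports Defs "Jordan_Normal_Form.Determinant"
begin

text \<open>
  An orthogonal matrix \<open>A\<close> of size \<open>2n\<close> with \<open>A\<^sup>m = 1\<close>, \<open>m = 2k + 1\<close>, is conjugate to a block
  diagonal matrix of \<open>n\<close> plane rotations with angles \<open>2 \<pi> j / m\<close>, \<open>j \<le> k\<close>: as \<open>m\<close> is odd, \<open>-1\<close> is
  not an eigenvalue, so the fixed space has even dimension and splits into planes with \<open>j = 0\<close>.
  The planes are found greedily: in the invariant orthogonal complement of the planes already found,
  some cosine average \<open>w = \<Sum>t<m. cos (2 \<pi> j t / m) A\<^sup>t v\<close> of a nonzero \<open>v\<close> is nonzero, and it
  satisfies \<open>A\<^sup>2 w + w = 2 cos (2 \<pi> j / m) A w\<close>. The multiplicity of each \<open>j\<close> is recovered from the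
  traces of the powers of \<open>A\<close> by orthogonality of the cosines, so the classes correspond to the
  multisets of size \<open>n\<close> over \<open>{0..k}\<close>.
\<close>

section \<open>Cosine sums over roots of unity\<close>

lemma sum_lessThan_shift_periodic:
  fixes f :: "nat \<Rightarrow> 'a::ab_group_add"
  assumes "f m = f 0"
  shows "(\<Sum>t<m. f (Suc t)) = (\<Sum>t<m. f t)"
  using sum.lessThan_Suc_shift[of f m] assms by simp

text \<open>The argument of the \<open>j\<close>-th power of the primitive \<open>m\<close>-th root
  of unity \<open>exp (2 pi i / m)\<close>.\<close>

definition angle :: "nat \<Rightarrow> nat \<Rightarrow> real" where
  "angle m j = 2 * pi * real j / real m"

lemma cos_add_shift:
  fixes x y :: real
  shows "cos x + cos (x + 2 * y) = 2 * cos y * cos (x + y)"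
proof -
  have "cos x = cos ((x + y) - y)" "cos (x + 2 * y) = cos ((x + y) + y)"
    by (simp_all add: algebra_simps)
  then show ?thesis
    by (simp only: cos_add[of "x + y" y] cos_diff[of "x + y" y]) (simp add: algebra_simps)
qed

text \<open>A Chebyshev recurrence: the cosine sequence is annihilated by
  \<open>X^2 - 2 cos (angle m j) X + 1\<close> in the shift operator \<open>X\<close>. Both the
  vanishing of full cosine sums and the equation of an invariant plane rest on it.\<close>

lemma cos_angle_step:
  "cos (angle m j * real t) + cos (angle m j * real (Suc (Suc t)))
    = 2 * cos (angle m j) * cos (angle m j * real (Suc t))"
  using cos_add_shift[of "angle m j * real t" "angle m j"] by (simp add: algebra_simps)

lemma cos_angle_period:
  assumes "0 < m"
  shows "cos (angle m j * real (t + m)) = cos (angle m j * real t)"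
proof -
  have "angle m j * real (t + m) = angle m j * real t + 2 * pi * of_nat j"
    using assms by (simp add: angle_def field_simps)
  then show ?thesis
    by (metis cos_add cos_2npi sin_2npi diff_zero mult.commute mult.right_neutral mult_zero_right mult.assoc)
qed

lemma cos_angle_eq_1_iff:
  assumes "0 < m"
  shows "cos (angle m j) = 1 \<longleftrightarrow> m dvd j"
proof
  assume "cos (angle m j) = 1"
  then obtain x :: int where "angle m j = x * 2 * pi"
    using cos_one_2pi_int by auto
  then have "real j = real_of_int x * real m"
    using assms by (simp add: angle_def field_simps)
  then have "int j = x * int m"
    by (metis of_int_eq_iff of_int_mult of_int_of_nat_eq)
  then show "m dvd j"
    by (metis dvd_triv_right int_dvd_int_iff)
next
  assume "m dvd j"
  then obtain q where "j = m * q" ..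
  then have "angle m j = 2 * real q * pi"
    using assms by (simp add: angle_def)
  then show "cos (angle m j) = 1"
    by (simp only: cos_2npi)
qed

text \<open>Orthogonality of characters in real form. A sum \<open>S\<close> over a full period is
  unchanged by shifts, so the recurrence gives \<open>2 * S = 2 * cos (angle m j) * S\<close>, hence
  \<open>S = 0\<close> unless the cosine is 1.\<close>

lemma sum_cos_angle:
  assumes m: "0 < m"
  shows "(\<Sum>t<m. cos (angle m j * real t)) = (if m dvd j then real m else 0)"
proof (cases "m dvd j")
  case True
  then obtain q where q: "j = m * q" ..
  have "cos (angle m j * real t) = 1" for t
  proof -
    have "angle m j * real t = of_nat (q * t) * (2 * pi)"
      using m q by (simp add: angle_def)
    then show ?thesis by (metis cos_2npi mult.assoc mult.commute)
  qed
  with True show ?thesis by simp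
next
  case False
  let ?g = "\<lambda>t. cos (angle m j * real t)"
  have s1: "(\<Sum>t<m. ?g (Suc t)) = (\<Sum>t<m. ?g t)"
    using cos_angle_period[OF m, of j 0] by (intro sum_lessThan_shift_periodic) simp
  have s2: "(\<Sum>t<m. ?g (Suc (Suc t))) = (\<Sum>t<m. ?g (Suc t))"
    using cos_angle_period[OF m, of j 1] by (intro sum_lessThan_shift_periodic) (simp add: add.commute)
  have "(\<Sum>t<m. ?g t) + (\<Sum>t<m. ?g (Suc (Suc t))) = 2 * cos (angle m j) * (\<Sum>t<m. ?g (Suc t))"
    by (simp only: sum_distrib_left cos_angle_step flip: sum.distrib)
  then have "(1 - cos (angle m j)) * (\<Sum>t<m. ?g t) = 0"
    unfolding s2 s1 by (simp add: algebra_simps)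
  with False show ?thesis
    using cos_angle_eq_1_iff[OF m, of j] by simp
qed

section \<open>Invariant planes of isometries\<close>

definition ortho_compl :: "nat \<Rightarrow> real vec set \<Rightarrow> real vec set" where
  "ortho_compl N U = {x \<in> carrier_vec N. \<forall>u\<in>U. u \<bullet> x = 0}"

text \<open>The \<open>l\<close> vectors, padded with zero vectors to \<open>N\<close> rows, form a
  square matrix with a zero row. Its determinant vanishes, and a nonzero kernel vector is orthogonal
  to every row.\<close>

lemma exists_nonzero_ortho:
  fixes u :: "nat \<Rightarrow> real vec"
  assumes "l < N" and "\<And>r. r < l \<Longrightarrow> u r \<in> carrier_vec N"
  obtains v where "v \<in> ortho_compl N (u ` {..<l})" "v \<noteq> 0\<^sub>v N"
proof -
  define M where "M = mat\<^sub>r N N (\<lambda>r. if r < l then u r else 0\<^sub>v N)"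
  have M: "M \<in> carrier_mat N N" by (simp add: M_def)
  \<comment> \<open>The branch \<open>r = l\<close> changes nothing, as row \<open>l\<close> is
    already zero; it gives \<open>M\<close> the shape that \<open>det_row_0\<close> expects.\<close>
  have "M = mat\<^sub>r N N (\<lambda>r. if r = l then 0\<^sub>v N else if r < l then u r else 0\<^sub>v N)"
    unfolding M_def by (rule arg_cong[of _ _ "mat\<^sub>r N N"]) auto
  then have "det M = 0"
    using det_row_0[of l N "\<lambda>r. if r < l then u r else 0\<^sub>v N"] assms by auto
  then obtain v where v: "v \<in> carrier_vec N" "v \<noteq> 0\<^sub>v N" "M *\<^sub>v v = 0\<^sub>v N"
    using det_0_iff_vec_prod_zero_field[OF M] by auto
  have "u r \<bullet> v = 0" if "r < l" for r
  proof -
    have "row M r = u r"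
      using that assms by (intro eq_vecI) (auto simp: M_def)
    moreover have "(M *\<^sub>v v) $ r = row M r \<bullet> v"
      using that assms M by simp
    ultimately show ?thesis using v that assms by simp
  qed
  with v show thesis by (intro that[of v]) (auto simp: ortho_compl_def)
qed

text \<open>Defined by coordinates, so that every rearrangement of the combination is one of real
  sums.\<close>

definition vec_comb :: "nat \<Rightarrow> (nat \<Rightarrow> real) \<Rightarrow> (nat \<Rightarrow> real vec) \<Rightarrow> nat \<Rightarrow> real vec" where
  "vec_comb N c a m = vec N (\<lambda>i. \<Sum>t<m. c t * a t $ i)"

lemma vec_comb_carrier[simp]: "vec_comb N c a m \<in> carrier_vec N"
  by (simp add: vec_comb_def)

lemma scalar_prod_vec_comb:
  assumes "u \<in> carrier_vec N" "\<And>t. a t \<in> carrier_vec N"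
  shows "u \<bullet> vec_comb N c a m = (\<Sum>t<m. c t * (u \<bullet> a t))"
proof -
  have d: "dim_vec (a t) = N" for t using assms(2)[of t] by auto
  have "u \<bullet> vec_comb N c a m = (\<Sum>i<N. \<Sum>t<m. u $ i * (c t * a t $ i))"
    by (simp add: scalar_prod_def vec_comb_def sum_distrib_left atLeast0LessThan)
  also have "\<dots> = (\<Sum>t<m. \<Sum>i<N. u $ i * (c t * a t $ i))"
    by (rule sum.swap)
  also have "\<dots> = (\<Sum>t<m. c t * (u \<bullet> a t))"
    by (simp add: scalar_prod_def sum_distrib_left atLeast0LessThan d mult.left_commute)
  finally show ?thesis .
qed

lemma mult_mat_vec_comb:
  assumes "A \<in> carrier_mat N N" "\<And>t. a t \<in> carrier_vec N"
  shows "A *\<^sub>v vec_comb N c a m = vec_comb N c (\<lambda>t. A *\<^sub>v a t) m"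
proof (rule eq_vecI)
  fix i assume i: "i < dim_vec (vec_comb N c (\<lambda>t. A *\<^sub>v a t) m)"
  then have i: "i < N" by (simp add: vec_comb_def)
  have d: "dim_row A = N" using assms by auto
  have "(A *\<^sub>v vec_comb N c a m) $ i = row A i \<bullet> vec_comb N c a m"
    using i assms by simp
  also have "\<dots> = (\<Sum>t<m. c t * (row A i \<bullet> a t))"
    using assms i by (intro scalar_prod_vec_comb) auto
  finally show "(A *\<^sub>v vec_comb N c a m) $ i = vec_comb N c (\<lambda>t. A *\<^sub>v a t) m $ i"
    using i d by (simp add: vec_comb_def)
qed (use assms in \<open>auto simp: vec_comb_def\<close>)

text \<open>The equation says that \<open>X^2 - 2 cos (angle m j) X + 1\<close>, evaluated at
  \<open>A\<close>, kills \<open>w\<close>. For \<open>j > 0\<close> this is the product of the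
  factors of \<open>X^m - 1\<close> at two conjugate roots of unity, so the argument stays over the
  reals. For \<open>j = 0\<close> it says only \<open>(A - 1)^2 w = 0\<close>.\<close>

lemma exists_plane_vector:
  assumes A: "A \<in> carrier_mat N N" and m: "m = 2 * k + 1"
    and U: "U \<subseteq> carrier_vec N"
    and inv: "\<And>x. x \<in> ortho_compl N U \<Longrightarrow> A *\<^sub>v x \<in> ortho_compl N U"
    and v: "v \<in> ortho_compl N U" "v \<noteq> 0\<^sub>v N"
    and per: "A ^\<^sub>m m = 1\<^sub>m N"
  obtains j w where "j \<le> k" "w \<in> ortho_compl N U" "w \<noteq> 0\<^sub>v N"
    "A *\<^sub>v (A *\<^sub>v w) + w = (2 * cos (angle m j)) \<cdot>\<^sub>v (A *\<^sub>v w)"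
proof -
  define a where "a t = A ^\<^sub>m t *\<^sub>v v" for t
  have vc: "v \<in> carrier_vec N" using v by (simp add: ortho_compl_def)
  have P: "A ^\<^sub>m t \<in> carrier_mat N N" for t using A by (rule pow_carrier_mat)
  have ac: "a t \<in> carrier_vec N" for t
    unfolding a_def using P[of t] vc by auto
  have powS: "A ^\<^sub>m Suc t = A * A ^\<^sub>m t" for t
  proof (induction t)
    case 0
    then show ?case using A by simp
  next
    case (Suc t)
    have "A ^\<^sub>m Suc (Suc t) = A ^\<^sub>m Suc t * A" by simp
    also have "\<dots> = A * A ^\<^sub>m t * A" by (simp only: Suc)
    also have "\<dots> = A * (A ^\<^sub>m t * A)" using A P[of t] by (intro assoc_mult_mat) auto
    finally show ?case by simp
  qed
  have aS: "A *\<^sub>v a t = a (Suc t)" for t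
    unfolding a_def powS by (rule assoc_mult_mat_vec[OF A P vc, symmetric])
  have a0: "a 0 = v" using A vc by (simp add: a_def)
  have am: "a m = v" using per vc by (simp add: a_def)
  have am1: "a (Suc m) = a 1" using am a0 by (simp flip: aS)
  have aU: "a t \<in> ortho_compl N U" for t
    by (induction t) (use v a0 inv aS in \<open>auto simp flip: aS\<close>)
  txt \<open>The real discrete Fourier components of the orbit of \<^term>\<open>v\<close> under \<^term>\<open>A\<close>; they add up to
    \<^term>\<open>real m \<cdot>\<^sub>v v\<close>, so not all of them vanish.\<close>
  define w where "w j = vec_comb N (\<lambda>t. cos (angle m j * real t)) a m" for j
  have m0: "0 < m" using m by simp
  have wU: "w j \<in> ortho_compl N U" for j
  proof -
    have "u \<bullet> w j = 0" if "u \<in> U" for u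
      unfolding w_def using that U aU
      by (subst scalar_prod_vec_comb) (auto simp: ac ortho_compl_def)
    then show ?thesis by (simp add: ortho_compl_def w_def)
  qed
  have eq: "A *\<^sub>v (A *\<^sub>v w j) + w j = (2 * cos (angle m j)) \<cdot>\<^sub>v (A *\<^sub>v w j)" for j
  proof -
    let ?g = "\<lambda>t. cos (angle m j * real t)"
    have Aw: "A *\<^sub>v w j = vec_comb N ?g (\<lambda>t. a (Suc t)) m"
      unfolding w_def using A ac by (simp add: mult_mat_vec_comb aS)
    have AAw: "A *\<^sub>v (A *\<^sub>v w j) = vec_comb N ?g (\<lambda>t. a (Suc (Suc t))) m"
      unfolding Aw using A ac by (simp add: mult_mat_vec_comb aS)
    have per0: "?g m = ?g 0" using cos_angle_period[OF m0, of j 0] by simp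
    have per1: "?g (Suc m) = ?g 1" using cos_angle_period[OF m0, of j 1] by (simp add: add.commute)
    \<comment> \<open>All three sums are re-indexed to carry \<open>a (Suc (Suc t))\<close>, since
      coefficients and orbit both have period \<open>m\<close>; then \<open>cos_angle_step\<close>
      compares the coefficients.\<close>
    have "(\<Sum>t<m. ?g t * a (Suc (Suc t)) $ i) + (\<Sum>t<m. ?g t * a t $ i)
        = 2 * cos (angle m j) * (\<Sum>t<m. ?g t * a (Suc t) $ i)" for i
    proof -
      have "(\<Sum>t<m. ?g t * a (Suc t) $ i) = (\<Sum>t<m. ?g (Suc t) * a (Suc (Suc t)) $ i)"
        using per0 am1 by (intro sum_lessThan_shift_periodic[symmetric]) simp
      moreover have "(\<Sum>t<m. ?g t * a t $ i) = (\<Sum>t<m. ?g (Suc (Suc t)) * a (Suc (Suc t)) $ i)"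
      proof -
        have "(\<Sum>t<m. ?g t * a t $ i) = (\<Sum>t<m. ?g (Suc t) * a (Suc t) $ i)"
          using per0 am a0 by (intro sum_lessThan_shift_periodic[symmetric]) simp
        also have "\<dots> = (\<Sum>t<m. ?g (Suc (Suc t)) * a (Suc (Suc t)) $ i)"
          using per1 am1 by (intro sum_lessThan_shift_periodic[symmetric]) simp
        finally show ?thesis .
      qed
      moreover have "(\<Sum>t<m. ?g t * a (Suc (Suc t)) $ i) + (\<Sum>t<m. ?g (Suc (Suc t)) * a (Suc (Suc t)) $ i)
          = (\<Sum>t<m. 2 * cos (angle m j) * (?g (Suc t) * a (Suc (Suc t)) $ i))"
        unfolding sum.distrib[symmetric] distrib_right[symmetric] cos_angle_step mult.assoc ..
      ultimately show ?thesis
        by (simp only: sum_distrib_left)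
    qed
    then show ?thesis
      unfolding AAw unfolding Aw unfolding w_def by (intro eq_vecI) (simp_all add: vec_comb_def)
  qed
  have "\<exists>j<m. w j \<noteq> 0\<^sub>v N"
  proof (rule ccontr)
    assume "\<not> (\<exists>j<m. w j \<noteq> 0\<^sub>v N)"
    then have z: "w j = 0\<^sub>v N" if "j < m" for j using that by simp
    have "v $ i = 0" if i: "i < N" for i
    proof -
      have "0 = (\<Sum>j<m. w j $ i)" using z i by simp
      also have "\<dots> = (\<Sum>j<m. \<Sum>t<m. cos (angle m j * real t) * a t $ i)"
        using i by (simp add: w_def vec_comb_def)
      also have "\<dots> = (\<Sum>t<m. \<Sum>j<m. cos (angle m j * real t) * a t $ i)"
        by (rule sum.swap)
      \<comment> \<open>\<open>angle m j * real t\<close> is symmetric in \<open>j\<close> and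
        \<open>t\<close>, so the sum over the frequencies \<open>j\<close> is again a full cosine
        sum, and only \<open>t = 0\<close> survives.\<close>
      also have "\<dots> = (\<Sum>t<m. (\<Sum>j<m. cos (angle m t * real j)) * a t $ i)"
        unfolding sum_distrib_right
        by (intro sum.cong refl) (simp add: angle_def mult_ac)
      also have "\<dots> = (\<Sum>t<m. if t = 0 then real m * v $ i else 0)"
        using m0 a0 by (intro sum.cong) (auto simp: sum_cos_angle dvd_imp_le nat_dvd_not_less)
      also have "\<dots> = real m * v $ i" using m0 by simp
      finally show ?thesis using m0 by simp
    qed
    then have "v = 0\<^sub>v N" using vc by (intro eq_vecI) auto
    with v show False by simp
  qed
  then obtain j where j: "j < m" "w j \<noteq> 0\<^sub>v N" by auto
  show thesis
  proof (cases "j \<le> k")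
    case True
    then show ?thesis using that[of j "w j"] j wU eq by blast
  next
    case False
    \<comment> \<open>The frequencies \<open>j\<close> and \<open>m - j\<close> have the same
      cosine, so the same vector \<open>w j\<close> serves for the reflected index, which is at most
      \<open>k\<close>.\<close>
    then have le: "m - j \<le> k" using m by simp
    have "angle m (m - j) = 2 * pi - angle m j"
      using j m0 by (simp add: angle_def of_nat_diff field_simps)
    then have "cos (angle m (m - j)) = cos (angle m j)" by simp
    then show ?thesis using that[of "m - j" "w j"] le j wU eq by metis
  qed
qed

section \<open>Inner products and planes of a single isometry\<close>

lemma scalar_prod_lincomb_right:
  fixes x y z :: "real vec"
  assumes "x \<in> carrier_vec N" "y \<in> carrier_vec N" "z \<in> carrier_vec N"
  shows "z \<bullet> (a \<cdot>\<^sub>v x + b \<cdot>\<^sub>v y) = a * (z \<bullet> x) + b * (z \<bullet> y)"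
  using assms by (subst scalar_prod_add_distrib[of _ N]) auto

lemma scalar_prod_lincomb_left:
  fixes x y z :: "real vec"
  assumes "x \<in> carrier_vec N" "y \<in> carrier_vec N" "z \<in> carrier_vec N"
  shows "(a \<cdot>\<^sub>v x + b \<cdot>\<^sub>v y) \<bullet> z = a * (x \<bullet> z) + b * (y \<bullet> z)"
  using assms by (subst add_scalar_prod_distrib[of _ N]) auto

lemma mult_mat_vec_lincomb:
  fixes A :: "real mat"
  assumes "A \<in> carrier_mat N N" "x \<in> carrier_vec N" "y \<in> carrier_vec N"
  shows "A *\<^sub>v (a \<cdot>\<^sub>v x + b \<cdot>\<^sub>v y) = a \<cdot>\<^sub>v (A *\<^sub>v x) + b \<cdot>\<^sub>v (A *\<^sub>v y)"
  using assms by (subst mult_add_distrib_mat_vec[of _ N N]) (auto simp: mult_mat_vec[of _ N N])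

lemma ortho_compl_lincomb:
  assumes "U \<subseteq> carrier_vec N" "x \<in> ortho_compl N U" "y \<in> ortho_compl N U"
  shows "a \<cdot>\<^sub>v x + b \<cdot>\<^sub>v y \<in> ortho_compl N U"
proof -
  have "u \<bullet> (a \<cdot>\<^sub>v x + b \<cdot>\<^sub>v y) = 0" if "u \<in> U" for u
    using that assms by (subst scalar_prod_lincomb_right[of _ N]) (auto simp: ortho_compl_def)
  then show ?thesis using assms by (auto simp: ortho_compl_def)
qed

lemma ortho_compl_smult:
  assumes "U \<subseteq> carrier_vec N" "x \<in> ortho_compl N U"
  shows "a \<cdot>\<^sub>v x \<in> ortho_compl N U"
proof -
  have "u \<bullet> (a \<cdot>\<^sub>v x) = 0" if "u \<in> U" for u
    using that assms by (subst scalar_prod_smult_distrib[of _ N]) (auto simp: ortho_compl_def)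
  then show ?thesis using assms by (auto simp: ortho_compl_def)
qed

lemma scalar_prod_self_pos:
  fixes v :: "real vec"
  assumes "v \<in> carrier_vec N" "v \<noteq> 0\<^sub>v N"
  shows "0 < v \<bullet> v"
proof -
  obtain i where "i < N" "v $ i \<noteq> 0" using assms by (metis eq_vecI carrier_vecD index_zero_vec)
  then show ?thesis
    using assms by (auto simp: scalar_prod_def intro!: sum_pos2[of _ i])
qed

lemma scalar_prod_isometry:
  fixes A :: "real mat"
  assumes "A \<in> carrier_mat N N" "transpose_mat A * A = 1\<^sub>m N"
    and "x \<in> carrier_vec N" "y \<in> carrier_vec N"
  shows "(A *\<^sub>v x) \<bullet> (A *\<^sub>v y) = x \<bullet> y"
proof -
  have "(A *\<^sub>v x) \<bullet> (A *\<^sub>v y) = (transpose_mat A *\<^sub>v (A *\<^sub>v x)) \<bullet> y"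
    using assms by (intro transpose_vec_mult_scalar[symmetric]) auto
  also have "transpose_mat A *\<^sub>v (A *\<^sub>v x) = (transpose_mat A * A) *\<^sub>v x"
    using assms by (intro assoc_mult_mat_vec[symmetric]) auto
  finally show ?thesis using assms by simp
qed

lemma exists_unit_multiple:
  fixes w :: "real vec"
  assumes "w \<in> carrier_vec N" "w \<noteq> 0\<^sub>v N"
  obtains r where "(r \<cdot>\<^sub>v w) \<bullet> (r \<cdot>\<^sub>v w) = 1"
proof
  have p: "0 < w \<bullet> w" by (rule scalar_prod_self_pos[OF assms])
  then show "((1 / sqrt (w \<bullet> w)) \<cdot>\<^sub>v w) \<bullet> ((1 / sqrt (w \<bullet> w)) \<cdot>\<^sub>v w) = 1"
    using assms by (simp add: field_simps)
qed

locale isometry =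
  fixes N :: nat and A :: "real mat"
  assumes A: "A \<in> carrier_mat N N" and iso: "transpose_mat A * A = 1\<^sub>m N"
begin

lemma A_carrier[simp]: "x \<in> carrier_vec N \<Longrightarrow> A *\<^sub>v x \<in> carrier_vec N"
  using A by auto

lemma isom: "x \<in> carrier_vec N \<Longrightarrow> y \<in> carrier_vec N \<Longrightarrow> (A *\<^sub>v x) \<bullet> (A *\<^sub>v y) = x \<bullet> y"
  by (rule scalar_prod_isometry[OF A iso])

text \<open>Pair the equation with \<open>A *\<^sub>v x\<close>: since \<open>A\<close> preserves
  inner products, the left side becomes \<open>2 * (x \<bullet> (A *\<^sub>v x))\<close> and the
  right side \<open>2 * c * (x \<bullet> x)\<close>.\<close>

lemma plane_vector_angle:
  assumes x: "x \<in> carrier_vec N"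
    and eq: "A *\<^sub>v (A *\<^sub>v x) + x = (2 * c) \<cdot>\<^sub>v (A *\<^sub>v x)"
  shows "x \<bullet> (A *\<^sub>v x) = c * (x \<bullet> x)"
proof -
  have "(A *\<^sub>v x) \<bullet> (A *\<^sub>v (A *\<^sub>v x) + x) = (2 * c) * ((A *\<^sub>v x) \<bullet> (A *\<^sub>v x))"
    unfolding eq using x by simp
  then show ?thesis
    using x by (simp add: scalar_prod_add_distrib[of _ N] isom comm_scalar_prod[of "A *\<^sub>v x" N x])
qed

text \<open>The equation alone would allow a Jordan block with eigenvalue 1. For an isometry,
  \<open>plane_vector_angle\<close> with \<open>c = 1\<close> shows that the difference of
  \<open>A *\<^sub>v x\<close> and \<open>x\<close> has length 0.\<close>

lemma fixed_of_plane_vector: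
  assumes x: "x \<in> carrier_vec N"
    and eq: "A *\<^sub>v (A *\<^sub>v x) + x = (2 * 1) \<cdot>\<^sub>v (A *\<^sub>v x)"
  shows "A *\<^sub>v x = x"
proof (rule ccontr)
  assume ne: "A *\<^sub>v x \<noteq> x"
  \<comment> \<open>The difference is written as a linear combination so that the bilinearity lemmas
    apply to it.\<close>
  let ?d = "1 \<cdot>\<^sub>v (A *\<^sub>v x) + (-1) \<cdot>\<^sub>v x"
  have "(a \<cdot>\<^sub>v (A *\<^sub>v x) + b \<cdot>\<^sub>v x) \<bullet> (a \<cdot>\<^sub>v (A *\<^sub>v x) + b \<cdot>\<^sub>v x)
      = (a + b) * (a + b) * (x \<bullet> x)" for a b
    using x plane_vector_angle[OF x eq]
    by (simp add: scalar_prod_lincomb_left[of _ N] scalar_prod_lincomb_right[of _ N] isom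
        comm_scalar_prod[of "A *\<^sub>v x" N x] algebra_simps)
  from this[of 1 "-1"] have "?d \<bullet> ?d = 0" by simp
  moreover have "?d \<noteq> 0\<^sub>v N"
  proof
    assume d: "?d = 0\<^sub>v N"
    have "A *\<^sub>v x = x"
    proof (rule eq_vecI)
      fix i assume "i < dim_vec x"
      then show "(A *\<^sub>v x) $ i = x $ i"
        using arg_cong[OF d, of "\<lambda>v. v $ i"] x A by simp
    qed (use x A in auto)
    with ne show False by simp
  qed
  ultimately show False using scalar_prod_self_pos[of ?d N] x by simp
qed

text \<open>\<open>x\<close> is the normalised \<open>w\<close>, and \<open>y\<close> arises from
  \<open>A *\<^sub>v x\<close> by Gram-Schmidt. The part of \<open>A *\<^sub>v x\<close> orthogonal
  to \<open>x\<close> has length \<open>\<bar>sin \<theta>\<bar>\<close>; dividing by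
  \<open>sin \<theta>\<close>, sign included, gives a unit vector with the right
  orientation.\<close>

lemma exists_rotation_pair:
  assumes U: "U \<subseteq> carrier_vec N"
    and inv: "\<And>x. x \<in> ortho_compl N U \<Longrightarrow> A *\<^sub>v x \<in> ortho_compl N U"
    and w: "w \<in> ortho_compl N U" "w \<noteq> 0\<^sub>v N"
    and eq: "A *\<^sub>v (A *\<^sub>v w) + w = (2 * cos \<theta>) \<cdot>\<^sub>v (A *\<^sub>v w)"
    and s: "sin \<theta> \<noteq> 0"
  obtains x y where "x \<in> ortho_compl N U" "y \<in> ortho_compl N U"
    "x \<bullet> x = 1" "y \<bullet> y = 1" "x \<bullet> y = 0"
    "A *\<^sub>v x = cos \<theta> \<cdot>\<^sub>v x + sin \<theta> \<cdot>\<^sub>v y"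
    "A *\<^sub>v y = (- sin \<theta>) \<cdot>\<^sub>v x + cos \<theta> \<cdot>\<^sub>v y"
proof -
  have wc: "w \<in> carrier_vec N" using w by (simp add: ortho_compl_def)
  obtain r where r: "(r \<cdot>\<^sub>v w) \<bullet> (r \<cdot>\<^sub>v w) = 1"
    using exists_unit_multiple[OF wc w(2)] .
  define x where "x = r \<cdot>\<^sub>v w"
  have xc: "x \<in> carrier_vec N" using wc by (simp add: x_def)
  have xU: "x \<in> ortho_compl N U"
    unfolding x_def by (rule ortho_compl_smult[OF U w(1)])
  have xx: "x \<bullet> x = 1" using r by (simp add: x_def)
  have Ax: "A *\<^sub>v x = r \<cdot>\<^sub>v (A *\<^sub>v w)" and AAx: "A *\<^sub>v (A *\<^sub>v x) = r \<cdot>\<^sub>v (A *\<^sub>v (A *\<^sub>v w))"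
    using A wc by (auto simp: x_def mult_mat_vec[of _ N N])
  have "A *\<^sub>v (A *\<^sub>v x) + x = r \<cdot>\<^sub>v (A *\<^sub>v (A *\<^sub>v w) + w)"
    unfolding AAx by (simp add: x_def smult_add_distrib_vec[of _ N] wc)
  also have "\<dots> = (2 * cos \<theta>) \<cdot>\<^sub>v (A *\<^sub>v x)"
    unfolding eq Ax by (simp add: smult_smult_assoc mult.commute)
  finally have eqx: "A *\<^sub>v (A *\<^sub>v x) + x = (2 * cos \<theta>) \<cdot>\<^sub>v (A *\<^sub>v x)" .
  have xAx: "x \<bullet> (A *\<^sub>v x) = cos \<theta>" using plane_vector_angle[OF xc eqx] xx by simp
  \<comment> \<open>This solves the desired formula for \<open>A *\<^sub>v x\<close> for
    \<open>y\<close>.\<close>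
  define y where "y = (1 / sin \<theta>) \<cdot>\<^sub>v (A *\<^sub>v x) + (- cos \<theta> / sin \<theta>) \<cdot>\<^sub>v x"
  have yU: "y \<in> ortho_compl N U"
    unfolding y_def by (rule ortho_compl_lincomb[OF U inv[OF xU] xU])
  have yc: "y \<in> carrier_vec N" using yU by (simp add: ortho_compl_def)
  have xy: "x \<bullet> y = 0"
    unfolding y_def using xc s by (simp add: scalar_prod_lincomb_right[of _ N] xAx xx)
  have Axy: "(A *\<^sub>v x) \<bullet> y = sin \<theta>"
    unfolding y_def using xc s comm_scalar_prod[of "A *\<^sub>v x" N x] xAx
    by (simp add: scalar_prod_lincomb_right[of _ N] xx isom field_simps flip: power2_eq_square)
  \<comment> \<open>Only the left factor is expanded, which leaves the known products
    \<open>Axy\<close> and \<open>xy\<close>.\<close>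
  have yy: "y \<bullet> y = 1"
    using s xc yc Axy xy
    by (subst (1) y_def) (simp add: scalar_prod_lincomb_left[of _ N])
  have dA: "dim_row A = N" "dim_vec x = N" using A xc by auto
  have 1: "A *\<^sub>v x = cos \<theta> \<cdot>\<^sub>v x + sin \<theta> \<cdot>\<^sub>v y"
    unfolding y_def using s dA by (intro eq_vecI) (auto simp: field_simps simp del: index_mult_mat_vec)
  have 2: "A *\<^sub>v y = (- sin \<theta>) \<cdot>\<^sub>v x + cos \<theta> \<cdot>\<^sub>v y"
  proof (rule eq_vecI)
    fix i assume "i < dim_vec ((- sin \<theta>) \<cdot>\<^sub>v x + cos \<theta> \<cdot>\<^sub>v y)"
    then have i: "i < N" using yc by auto
    \<comment> \<open>The quadratic equation eliminates the second iterate of \<open>A\<close>; the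
      rest is the Pythagorean identity for \<open>\<theta>\<close>.\<close>
    have e: "(A *\<^sub>v (A *\<^sub>v x)) $ i = 2 * cos \<theta> * (A *\<^sub>v x) $ i - x $ i"
      using arg_cong[OF eqx, of "\<lambda>v. v $ i"] i dA by (simp del: index_mult_mat_vec)
    have "A *\<^sub>v y = (1 / sin \<theta>) \<cdot>\<^sub>v (A *\<^sub>v (A *\<^sub>v x)) + (- cos \<theta> / sin \<theta>) \<cdot>\<^sub>v (A *\<^sub>v x)"
      unfolding y_def using A xc by (intro mult_mat_vec_lincomb) auto
    then have "(A *\<^sub>v y) $ i = (cos \<theta> * (A *\<^sub>v x) $ i - x $ i) / sin \<theta>"
      using i dA e s by (simp add: field_simps del: index_mult_mat_vec)
    also have "\<dots> = - sin \<theta> * x $ i + cos \<theta> * y $ i"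
      unfolding y_def using i dA s
      by (simp add: field_simps del: index_mult_mat_vec)
        (simp add: sin_cos_squared_add3 flip: mult.assoc distrib_right)
    finally show "(A *\<^sub>v y) $ i = ((- sin \<theta>) \<cdot>\<^sub>v x + cos \<theta> \<cdot>\<^sub>v y) $ i"
      using i dA yc by simp
  qed (use dA yc in auto)
  show thesis using that[OF xU yU xx yy xy 1 2] .
qed

end

section \<open>Orthonormal frames of rotation planes\<close>

text \<open>The pair at positions \<open>2*i\<close> and \<open>2*i+1\<close> spans the
  \<open>i\<close>-th plane. Only the first \<open>2*p\<close> vectors are constrained, so a frame
  can be extended by function update.\<close>

definition rot_frame ::
    "nat \<Rightarrow> real mat \<Rightarrow> (nat \<Rightarrow> real) \<Rightarrow> (nat \<Rightarrow> real vec) \<Rightarrow> nat \<Rightarrow> bool" where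
  "rot_frame N A \<theta> u p \<longleftrightarrow>
    (\<forall>r<2*p. u r \<in> carrier_vec N) \<and>
    (\<forall>r<2*p. \<forall>s<2*p. u r \<bullet> u s = of_bool (r = s)) \<and>
    (\<forall>i<p. A *\<^sub>v u (2*i) = cos (\<theta> i) \<cdot>\<^sub>v u (2*i) + sin (\<theta> i) \<cdot>\<^sub>v u (2*i+1) \<and>
           A *\<^sub>v u (2*i+1) = (- sin (\<theta> i)) \<cdot>\<^sub>v u (2*i) + cos (\<theta> i) \<cdot>\<^sub>v u (2*i+1))"

lemma sin_angle_pos:
  assumes "0 < j" "2 * j < m"
  shows "0 < sin (angle m j)"
proof (rule sin_gt_zero)
  show "0 < angle m j" using assms by (simp add: angle_def)
  have "2 * real j < real m" using assms by linarith
  then show "angle m j < pi" using assms by (simp add: angle_def field_simps)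
qed

lemma rot_frame_extend:
  assumes fr: "rot_frame N A \<theta> u p"
    and x: "x \<in> ortho_compl N (u ` {..<2*p})" and y: "y \<in> ortho_compl N (u ` {..<2*p})"
    and xy: "x \<bullet> x = 1" "y \<bullet> y = 1" "x \<bullet> y = 0"
    and Ax: "A *\<^sub>v x = cos \<phi> \<cdot>\<^sub>v x + sin \<phi> \<cdot>\<^sub>v y"
    and Ay: "A *\<^sub>v y = (- sin \<phi>) \<cdot>\<^sub>v x + cos \<phi> \<cdot>\<^sub>v y"
  shows "rot_frame N A (\<theta>(p := \<phi>)) (u(2*p := x, 2*p+1 := y)) (Suc p)"
proof -
  have c: "x \<in> carrier_vec N" "y \<in> carrier_vec N" "\<And>r. r < 2*p \<Longrightarrow> u r \<in> carrier_vec N"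
    using x y fr by (auto simp: ortho_compl_def rot_frame_def)
  have o: "u r \<bullet> x = 0" "u r \<bullet> y = 0" "x \<bullet> u r = 0" "y \<bullet> u r = 0" if "r < 2*p" for r
    using x y that c comm_scalar_prod[of "u r" N x] comm_scalar_prod[of "u r" N y]
    by (auto simp: ortho_compl_def)
  have yx: "y \<bullet> x = 0" using xy c comm_scalar_prod[of x N y] by simp
  have lt: "r < 2 * p" if "r < 2 * Suc p" "r \<noteq> 2 * p" "r \<noteq> Suc (2 * p)" for r
    using that by (auto simp: less_Suc_eq)
  show ?thesis
    unfolding rot_frame_def
  proof (intro conjI allI impI)
    fix r assume "r < 2 * Suc p"
    then show "(u(2*p := x, 2*p+1 := y)) r \<in> carrier_vec N"
      using c lt by auto
  next
    fix r s assume "r < 2 * Suc p" "s < 2 * Suc p"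
    then show "(u(2*p := x, 2*p+1 := y)) r \<bullet> (u(2*p := x, 2*p+1 := y)) s = of_bool (r = s)"
      using o xy yx lt[of r] lt[of s] fr by (auto simp: rot_frame_def)
  next
    fix i assume i: "i < Suc p"
    let ?u = "u(2*p := x, 2*p+1 := y)" and ?t = "\<theta>(p := \<phi>)"
    have "A *\<^sub>v ?u (2*i) = cos (?t i) \<cdot>\<^sub>v ?u (2*i) + sin (?t i) \<cdot>\<^sub>v ?u (2*i+1) \<and>
      A *\<^sub>v ?u (2*i+1) = (- sin (?t i)) \<cdot>\<^sub>v ?u (2*i) + cos (?t i) \<cdot>\<^sub>v ?u (2*i+1)"
    proof (cases "i = p")
      case True
      then show ?thesis using Ax Ay by simp
    next
      case False
      then have "i < p" "2*i \<noteq> 2*p+1" "2*i+1 \<noteq> 2*p" using i by presburger+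
      then show ?thesis using fr by (simp add: rot_frame_def)
    qed
    then show "A *\<^sub>v ?u (2*i) = cos (?t i) \<cdot>\<^sub>v ?u (2*i) + sin (?t i) \<cdot>\<^sub>v ?u (2*i+1)"
      "A *\<^sub>v ?u (2*i+1) = (- sin (?t i)) \<cdot>\<^sub>v ?u (2*i) + cos (?t i) \<cdot>\<^sub>v ?u (2*i+1)"
      by blast+
  qed
qed

context isometry
begin

text \<open>For \<open>x\<close> in the complement, \<open>A *\<^sub>v x\<close> is orthogonal to
  the images under \<open>A\<close> of the two vectors of each plane. These images are an invertible
  combination of the two vectors themselves.\<close>

lemma rot_frame_compl_invariant:
  assumes fr: "rot_frame N A \<theta> u p" and x: "x \<in> ortho_compl N (u ` {..<2*p})"
  shows "A *\<^sub>v x \<in> ortho_compl N (u ` {..<2*p})"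
proof -
  have xc: "x \<in> carrier_vec N" using x by (simp add: ortho_compl_def)
  have z: "u (2*i) \<bullet> (A *\<^sub>v x) = 0 \<and> u (2*i+1) \<bullet> (A *\<^sub>v x) = 0" if i: "i < p" for i
  proof -
    let ?a = "u (2*i) \<bullet> (A *\<^sub>v x)" and ?b = "u (2*i+1) \<bullet> (A *\<^sub>v x)"
    let ?c = "cos (\<theta> i)" and ?s = "sin (\<theta> i)"
    have c: "u (2*i) \<in> carrier_vec N" "u (2*i+1) \<in> carrier_vec N"
      using fr i by (auto simp: rot_frame_def)
    have o: "u (2*i) \<bullet> x = 0" "u (2*i+1) \<bullet> x = 0"
      using x i by (auto simp: ortho_compl_def)
    have "(A *\<^sub>v u (2*i)) \<bullet> (A *\<^sub>v x) = 0" "(A *\<^sub>v u (2*i+1)) \<bullet> (A *\<^sub>v x) = 0"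
      using isom c xc o by auto
    moreover have "A *\<^sub>v u (2*i) = ?c \<cdot>\<^sub>v u (2*i) + ?s \<cdot>\<^sub>v u (2*i+1)"
      "A *\<^sub>v u (2*i+1) = (- ?s) \<cdot>\<^sub>v u (2*i) + ?c \<cdot>\<^sub>v u (2*i+1)"
      using fr i by (auto simp: rot_frame_def)
    ultimately have e: "?c * ?a + ?s * ?b = 0" "- ?s * ?a + ?c * ?b = 0"
      using scalar_prod_lincomb_left[OF c A_carrier[OF xc]] by metis+
    \<comment> \<open>A homogeneous 2 by 2 system with determinant \<open>c * c + s * s = 1\<close>,
      solved by Cramer's rule.\<close>
    have "a = 0 \<and> b = 0" if "c * a + s * b = 0" "- s * a + c * b = 0" "c * c + s * s = 1" for a b c s :: real
    proof -
      have "(c * c + s * s) * a = c * (c * a + s * b) - s * (- s * a + c * b)"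
        "(c * c + s * s) * b = s * (c * a + s * b) + c * (- s * a + c * b)"
        by (simp_all add: algebra_simps)
      then show ?thesis using that by simp
    qed
    from this[OF e sin_cos_squared_add3] show ?thesis .
  qed
  have "u r \<bullet> (A *\<^sub>v x) = 0" if "r < 2*p" for r
  proof -
    have "r = 2 * (r div 2) \<or> r = 2 * (r div 2) + 1" "r div 2 < p" using that by presburger+
    then show ?thesis using z by metis
  qed
  then show ?thesis using A_carrier[OF xc] by (auto simp: ortho_compl_def)
qed

text \<open>A vector of frequency \<open>j > 0\<close> spans a plane together with its image,
  whereas \<open>j = 0\<close> yields only a fixed line. The bound \<open>2 * p + 2 \<le> N\<close>
  leaves room to search for a partner of that line.\<close>

lemma exists_next_pair:
  assumes per: "A ^\<^sub>m m = 1\<^sub>m N" and m: "m = 2 * k + 1"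
    and fr: "rot_frame N A \<theta> u p" and p: "2 * p + 2 \<le> N"
  obtains j x y where "j \<le> k" "x \<in> ortho_compl N (u ` {..<2*p})" "y \<in> ortho_compl N (u ` {..<2*p})"
    "x \<bullet> x = 1" "y \<bullet> y = 1" "x \<bullet> y = 0"
    "A *\<^sub>v x = cos (angle m j) \<cdot>\<^sub>v x + sin (angle m j) \<cdot>\<^sub>v y"
    "A *\<^sub>v y = (- sin (angle m j)) \<cdot>\<^sub>v x + cos (angle m j) \<cdot>\<^sub>v y"
proof -
  let ?U = "u ` {..<2*p}"
  have uc: "u r \<in> carrier_vec N" if "r < 2*p" for r
    using fr that by (simp add: rot_frame_def)
  have U: "?U \<subseteq> carrier_vec N" using uc by auto
  note inv = rot_frame_compl_invariant[OF fr]
  obtain v where v: "v \<in> ortho_compl N ?U" "v \<noteq> 0\<^sub>v N"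
    using exists_nonzero_ortho[of "2*p" N u] uc p by auto
  obtain j w where w: "j \<le> k" "w \<in> ortho_compl N ?U" "w \<noteq> 0\<^sub>v N"
    "A *\<^sub>v (A *\<^sub>v w) + w = (2 * cos (angle m j)) \<cdot>\<^sub>v (A *\<^sub>v w)"
    using exists_plane_vector[OF A m U inv v per] .
  show thesis
  proof (cases "j = 0")
    case False
    then have "sin (angle m j) \<noteq> 0" using sin_angle_pos[of j m] w m by simp
    from exists_rotation_pair[OF U inv w(2-4) this] show ?thesis
      using that[OF w(1)] by blast
  next
    case True
    have wc: "w \<in> carrier_vec N" using w by (simp add: ortho_compl_def)
    have Aw: "A *\<^sub>v w = w"
      using w(4) True by (intro fixed_of_plane_vector[OF wc]) (simp add: angle_def)
    txt \<open>A fixed vector needs a partner: search the complement of the frame enlarged by \<^term>\<open>w\<close>.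
      Either a genuine rotation plane or a second fixed vector turns up there.\<close>
    let ?u = "u(2*p := w)"
    let ?V = "?u ` {..<Suc (2*p)}"
    have Veq: "?V = insert w ?U"
      by (auto simp: lessThan_Suc)
    have V: "?V \<subseteq> carrier_vec N" unfolding Veq using U wc by simp
    have VU: "x \<in> ortho_compl N ?U" if "x \<in> ortho_compl N ?V" for x
      using that unfolding Veq by (auto simp: ortho_compl_def)
    have invV: "A *\<^sub>v x \<in> ortho_compl N ?V" if "x \<in> ortho_compl N ?V" for x
    proof -
      have "x \<in> carrier_vec N" "w \<bullet> x = 0" using that unfolding Veq by (auto simp: ortho_compl_def)
      then have "w \<bullet> (A *\<^sub>v x) = 0" using isom[OF wc, of x] Aw by simp
      with inv[OF VU[OF that]] show ?thesis unfolding Veq by (auto simp: ortho_compl_def)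
    qed
    have "?u r \<in> carrier_vec N" if "r < Suc (2*p)" for r
      using that uc wc by auto
    then obtain v' where v': "v' \<in> ortho_compl N ?V" "v' \<noteq> 0\<^sub>v N"
      using exists_nonzero_ortho[of "Suc (2*p)" N ?u] p by auto
    obtain j' w' where w': "j' \<le> k" "w' \<in> ortho_compl N ?V" "w' \<noteq> 0\<^sub>v N"
      "A *\<^sub>v (A *\<^sub>v w') + w' = (2 * cos (angle m j')) \<cdot>\<^sub>v (A *\<^sub>v w')"
      using exists_plane_vector[OF A m V invV v' per] .
    show ?thesis
    proof (cases "j' = 0")
      case False
      then have "sin (angle m j') \<noteq> 0" using sin_angle_pos[of j' m] w' m by simp
      \<comment> \<open>The fixed vector \<open>w\<close> is dropped here: the plane of frequency
        \<open>j'\<close> extends the old frame.\<close>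
      from exists_rotation_pair[OF V invV w'(2-4) this] show ?thesis
        using that[OF w'(1)] VU by metis
    next
      case True
      have wc': "w' \<in> carrier_vec N" using w' by (simp add: ortho_compl_def)
      have Aw': "A *\<^sub>v w' = w'"
        using w'(4) True by (intro fixed_of_plane_vector[OF wc']) (simp add: angle_def)
      have ww': "w \<bullet> w' = 0" using w'(2) unfolding Veq by (simp add: ortho_compl_def)
      obtain r where r: "(r \<cdot>\<^sub>v w) \<bullet> (r \<cdot>\<^sub>v w) = 1"
        using exists_unit_multiple[OF wc w(3)] .
      obtain r' where r': "(r' \<cdot>\<^sub>v w') \<bullet> (r' \<cdot>\<^sub>v w') = 1"
        using exists_unit_multiple[OF wc' w'(3)] .
      have o: "(r \<cdot>\<^sub>v w) \<bullet> (r' \<cdot>\<^sub>v w') = 0" using wc wc' ww' by simp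
      have "A *\<^sub>v (r \<cdot>\<^sub>v w) = r \<cdot>\<^sub>v w" "A *\<^sub>v (r' \<cdot>\<^sub>v w') = r' \<cdot>\<^sub>v w'"
        using A wc wc' Aw Aw' by (simp_all add: mult_mat_vec[of _ N N])
      \<comment> \<open>Two orthonormal fixed vectors count as a plane rotated by the angle 0, that
        is, of frequency 0.\<close>
      moreover have "cos (angle m 0) \<cdot>\<^sub>v (r \<cdot>\<^sub>v w) + sin (angle m 0) \<cdot>\<^sub>v (r' \<cdot>\<^sub>v w') = r \<cdot>\<^sub>v w"
        "(- sin (angle m 0)) \<cdot>\<^sub>v (r \<cdot>\<^sub>v w) + cos (angle m 0) \<cdot>\<^sub>v (r' \<cdot>\<^sub>v w') = r' \<cdot>\<^sub>v w'"
        using wc wc' by (auto simp: angle_def intro!: eq_vecI)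
      ultimately show ?thesis
        using that[OF _ ortho_compl_smult[OF U w(2)] ortho_compl_smult[OF U VU[OF w'(2)]] r r' o, of 0]
        by simp
    qed
  qed
qed

lemma exists_rot_frame:
  assumes per: "A ^\<^sub>m m = 1\<^sub>m N" and m: "m = 2 * k + 1" and p: "2 * p \<le> N"
  shows "\<exists>js u. (\<forall>i. js i \<le> k) \<and> rot_frame N A (\<lambda>i. angle m (js i)) u p"
  using p
proof (induction p)
  case 0
  \<comment> \<open>The bound on \<open>js\<close> concerns all indices, also those beyond the
    frame, so the empty frame takes the constant 0.\<close>
  then show ?case by (auto simp: rot_frame_def intro: exI[of _ "\<lambda>_. 0"])
next
  case (Suc p)
  then obtain js u where js: "\<forall>i. js i \<le> k" and fr: "rot_frame N A (\<lambda>i. angle m (js i)) u p"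
    by auto
  obtain j x y where j: "j \<le> k" and
    xy: "x \<in> ortho_compl N (u ` {..<2*p})" "y \<in> ortho_compl N (u ` {..<2*p})"
    "x \<bullet> x = 1" "y \<bullet> y = 1" "x \<bullet> y = 0"
    "A *\<^sub>v x = cos (angle m j) \<cdot>\<^sub>v x + sin (angle m j) \<cdot>\<^sub>v y"
    "A *\<^sub>v y = (- sin (angle m j)) \<cdot>\<^sub>v x + cos (angle m j) \<cdot>\<^sub>v y"
    using exists_next_pair[OF per m fr] Suc.prems by auto
  have "(\<lambda>i. angle m (js i))(p := angle m j) = (\<lambda>i. angle m ((js(p := j)) i))" by auto
  then have "rot_frame N A (\<lambda>i. angle m ((js(p := j)) i)) (u(2*p := x, 2*p+1 := y)) (Suc p)"
    using rot_frame_extend[OF fr xy] by simp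
  moreover have "\<forall>i. (js(p := j)) i \<le> k" using js j by simp
  ultimately show ?case by blast
qed

end

section \<open>Block rotation matrices and their traces\<close>

text \<open>Block \<open>i\<close> occupies the indices \<open>2*i\<close> and \<open>2*i+1\<close>.
  Its columns are the coordinates of the two images prescribed by \<open>rot_frame\<close>.\<close>

definition rot_mat :: "nat \<Rightarrow> (nat \<Rightarrow> real) \<Rightarrow> real mat" where
  "rot_mat n \<theta> = mat (2*n) (2*n) (\<lambda>(r, c).
     if r div 2 \<noteq> c div 2 then 0
     else if r = c then cos (\<theta> (r div 2))
     else if r < c then - sin (\<theta> (r div 2)) else sin (\<theta> (r div 2)))"

lemma rot_mat_carrier[simp]: "rot_mat n \<theta> \<in> carrier_mat (2*n) (2*n)"
  by (simp add: rot_mat_def)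

lemma rot_mat_index:
  assumes "i < n" "j < n"
  shows "rot_mat n \<theta> $$ (2*i, 2*j) = (if i = j then cos (\<theta> i) else 0)"
    "rot_mat n \<theta> $$ (2*i, Suc (2*j)) = (if i = j then - sin (\<theta> i) else 0)"
    "rot_mat n \<theta> $$ (Suc (2*i), 2*j) = (if i = j then sin (\<theta> i) else 0)"
    "rot_mat n \<theta> $$ (Suc (2*i), Suc (2*j)) = (if i = j then cos (\<theta> i) else 0)"
  using assms by (auto simp: rot_mat_def)

lemma rot_mat_transpose: "transpose_mat (rot_mat n \<theta>) = rot_mat n (\<lambda>i. - \<theta> i)"
  by (rule eq_matI) (auto simp: rot_mat_def)

lemma rot_mat_one: "rot_mat n (\<lambda>_. 0) = 1\<^sub>m (2*n)"
  by (rule eq_matI) (auto simp: rot_mat_def)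

lemma sum_lessThan_double:
  fixes f :: "nat \<Rightarrow> 'a::comm_monoid_add"
  shows "(\<Sum>r<2*n. f r) = (\<Sum>i<n. f (2*i) + f (2*i+1))"
  by (induction n) (simp_all add: add.assoc)

text \<open>Products become sums of angles, so powers, transposes and orthogonality of these
  matrices reduce to arithmetic with angles.\<close>

lemma rot_mat_mult: "rot_mat n \<theta> * rot_mat n \<phi> = rot_mat n (\<lambda>i. \<theta> i + \<phi> i)"
proof (rule eq_matI)
  fix r c assume "r < dim_row (rot_mat n (\<lambda>i. \<theta> i + \<phi> i))" "c < dim_col (rot_mat n (\<lambda>i. \<theta> i + \<phi> i))"
  then have rc: "r < 2*n" "c < 2*n" by (auto simp: rot_mat_def)
  define i where "i = r div 2"
  have i: "i < n" and r: "r = 2*i \<or> r = 2*i+1" using rc by (auto simp: i_def)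
  obtain j where c: "c = 2*j \<or> c = 2*j+1" by (meson oddE evenE)
  have j: "j < n" using c rc by auto
  have "(rot_mat n \<theta> * rot_mat n \<phi>) $$ (r, c) = (\<Sum>s<2*n. rot_mat n \<theta> $$ (r, s) * rot_mat n \<phi> $$ (s, c))"
    using rc by (simp add: rot_mat_def scalar_prod_def atLeast0LessThan)
  also have "\<dots> = (\<Sum>h<n. rot_mat n \<theta> $$ (r, 2*h) * rot_mat n \<phi> $$ (2*h, c)
      + rot_mat n \<theta> $$ (r, 2*h+1) * rot_mat n \<phi> $$ (2*h+1, c))"
    by (rule sum_lessThan_double)
  \<comment> \<open>Row \<open>r\<close> lies in block \<open>i\<close>, so it has zeros outside
    that block.\<close>
  also have "\<dots> = (\<Sum>h<n. if h = i then rot_mat n \<theta> $$ (r, 2*i) * rot_mat n \<phi> $$ (2*i, c)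
      + rot_mat n \<theta> $$ (r, 2*i+1) * rot_mat n \<phi> $$ (2*i+1, c) else 0)"
  proof (intro sum.cong refl)
    fix h assume "h \<in> {..<n}"
    then have h: "h < n" by simp
    show "rot_mat n \<theta> $$ (r, 2*h) * rot_mat n \<phi> $$ (2*h, c)
      + rot_mat n \<theta> $$ (r, 2*h+1) * rot_mat n \<phi> $$ (2*h+1, c)
      = (if h = i then rot_mat n \<theta> $$ (r, 2*i) * rot_mat n \<phi> $$ (2*i, c)
      + rot_mat n \<theta> $$ (r, 2*i+1) * rot_mat n \<phi> $$ (2*i+1, c) else 0)"
      using r by (cases "h = i") (auto simp: rot_mat_index[OF i h])
  qed
  also have "\<dots> = rot_mat n \<theta> $$ (r, 2*i) * rot_mat n \<phi> $$ (2*i, c)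
      + rot_mat n \<theta> $$ (r, 2*i+1) * rot_mat n \<phi> $$ (2*i+1, c)"
    using i by simp
  also have "\<dots> = rot_mat n (\<lambda>i. \<theta> i + \<phi> i) $$ (r, c)"
    using r c
    by (elim disjE) (simp_all add: rot_mat_index[OF i i] rot_mat_index[OF i j] cos_add sin_add)
  finally show "(rot_mat n \<theta> * rot_mat n \<phi>) $$ (r, c) = rot_mat n (\<lambda>i. \<theta> i + \<phi> i) $$ (r, c)" .
qed (auto simp: rot_mat_def)

lemma rot_mat_pow: "rot_mat n \<theta> ^\<^sub>m t = rot_mat n (\<lambda>i. real t * \<theta> i)"
proof (induction t)
  case 0
  then show ?case using rot_mat_one[of n] by (simp add: rot_mat_def)
next
  case (Suc t)
  then show ?case by (simp add: rot_mat_mult algebra_simps)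
qed

section \<open>Traces of powers and multiplicities of angles\<close>

definition mat_trace :: "real mat \<Rightarrow> real" where
  "mat_trace A = (\<Sum>i<dim_row A. A $$ (i, i))"

lemma mat_trace_mult_comm:
  assumes "A \<in> carrier_mat N N" "B \<in> carrier_mat N N"
  shows "mat_trace (A * B) = mat_trace (B * A)"
proof -
  have "mat_trace (A * B) = (\<Sum>i<N. \<Sum>j<N. A $$ (i, j) * B $$ (j, i))"
    using assms by (simp add: mat_trace_def scalar_prod_def atLeast0LessThan)
  also have "\<dots> = (\<Sum>j<N. \<Sum>i<N. A $$ (i, j) * B $$ (j, i))"
    by (rule sum.swap)
  also have "\<dots> = mat_trace (B * A)"
    using assms by (simp add: mat_trace_def scalar_prod_def atLeast0LessThan mult.commute)
  finally show ?thesis .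
qed

lemma mat_trace_rot_mat: "mat_trace (rot_mat n \<theta>) = (\<Sum>i<n. 2 * cos (\<theta> i))"
proof -
  have "mat_trace (rot_mat n \<theta>) = (\<Sum>r<2*n. cos (\<theta> (r div 2)))"
    by (simp add: mat_trace_def rot_mat_def)
  also have "\<dots> = (\<Sum>i<n. 2 * cos (\<theta> i))"
    by (subst sum_lessThan_double) simp
  finally show ?thesis .
qed

text \<open>The product formula splits the sum into full cosine sums of frequencies
  \<open>j + l\<close> and \<open>j - l\<close>; for \<open>j = l = 0\<close> both contribute, hence
  the factor 2. By symmetry \<open>l \<le> j\<close> may be assumed, which makes the natural
  subtraction exact.\<close>

lemma sum_cos_mult_cos_angle:
  assumes m: "m = 2 * k + 1" and "j \<le> k" "l \<le> k"
  shows "(\<Sum>t<m. cos (angle m j * real t) * (2 * cos (real t * angle m l)))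
    = (if j = l then if j = 0 then 2 * real m else real m else 0)"
proof -
  have *: "(\<Sum>t<m. cos (angle m j * real t) * (2 * cos (real t * angle m l)))
      = (if j = l then if j = 0 then 2 * real m else real m else 0)"
    if le: "l \<le> j" "j \<le> k" for j l
  proof -
    have a: "angle m (j + l) = angle m j + angle m l" "angle m (j - l) = angle m j - angle m l"
      using le by (simp_all add: angle_def of_nat_diff algebra_simps add_divide_distrib diff_divide_distrib)
    have "cos (angle m j * real t) * (2 * cos (real t * angle m l))
        = cos (angle m (j + l) * real t) + cos (angle m (j - l) * real t)" for t
      unfolding a by (simp add: algebra_simps cos_add cos_diff)
    then have "(\<Sum>t<m. cos (angle m j * real t) * (2 * cos (real t * angle m l)))
        = (\<Sum>t<m. cos (angle m (j + l) * real t)) + (\<Sum>t<m. cos (angle m (j - l) * real t))"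
      by (simp add: sum.distrib)
    also have "\<dots> = (if m dvd j + l then real m else 0) + (if m dvd j - l then real m else 0)"
      using m by (simp only: sum_cos_angle[OF zero_less_Suc] Suc_eq_plus1[symmetric])
    \<comment> \<open>\<open>j + l \<le> 2 * k < m\<close> leaves only \<open>j + l = 0\<close>,
      which is \<open>j = 0\<close> as \<open>l \<le> j\<close>.\<close>
    also have "m dvd j + l \<longleftrightarrow> j = 0"
      using m le by (auto dest: dvd_imp_le)
    also have "m dvd j - l \<longleftrightarrow> j = l"
      using m le by (auto dest: dvd_imp_le)
    finally show ?thesis using le by auto
  qed
  show ?thesis
  proof (cases "l \<le> j")
    case True
    then show ?thesis using * assms by blast
  next
    case False
    have "(\<Sum>t<m. cos (angle m j * real t) * (2 * cos (real t * angle m l)))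
        = (\<Sum>t<m. cos (angle m l * real t) * (2 * cos (real t * angle m j)))"
      by (intro sum.cong refl) (simp add: mult_ac)
    also have "\<dots> = 0" using *[of j l] False assms(3) by simp
    finally show ?thesis using False by auto
  qed
qed

text \<open>The trace of the \<open>t\<close>-th power is the sum of
  \<open>2 * cos (real t * angle m (js i))\<close>, so this cosine transform picks out the planes of
  frequency \<open>l\<close>.\<close>

lemma count_of_traces:
  assumes m: "m = 2 * k + 1" and js: "\<And>i. i < n \<Longrightarrow> js i \<le> k" and l: "l \<le> k"
  shows "(\<Sum>t<m. cos (angle m l * real t) * mat_trace (rot_mat n (\<lambda>i. angle m (js i)) ^\<^sub>m t))
    = (if l = 0 then 2 * real m else real m) * real (card {i. i < n \<and> js i = l})"
proof -
  have "(\<Sum>t<m. cos (angle m l * real t) * mat_trace (rot_mat n (\<lambda>i. angle m (js i)) ^\<^sub>m t))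
      = (\<Sum>t<m. \<Sum>i<n. cos (angle m l * real t) * (2 * cos (real t * angle m (js i))))"
    by (simp add: rot_mat_pow mat_trace_rot_mat sum_distrib_left)
  also have "\<dots> = (\<Sum>i<n. \<Sum>t<m. cos (angle m l * real t) * (2 * cos (real t * angle m (js i))))"
    by (rule sum.swap)
  also have "\<dots> = (\<Sum>i<n. if js i = l then if l = 0 then 2 * real m else real m else 0)"
    using sum_cos_mult_cos_angle[OF m l] js by (intro sum.cong) auto
  also have "\<dots> = (\<Sum>i\<in>{i. i < n \<and> js i = l}. if l = 0 then 2 * real m else real m)"
    by (intro sum.mono_neutral_cong_right) auto
  finally show ?thesis by simp
qed

text \<open>The frame vectors are the columns of \<open>Q\<close>. Entry \<open>(r, c)\<close> of
  \<open>transpose_mat Q * (A * Q)\<close> is then \<open>u r \<bullet> (A *\<^sub>v u c)\<close>,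
  which orthonormality evaluates.\<close>

lemma conj_of_rot_frame:
  assumes A: "A \<in> carrier_mat (2*n) (2*n)" and fr: "rot_frame (2*n) A \<theta> u n"
  obtains Q where "Q \<in> carrier (orthogonal_group (2*n))" "A = Q * rot_mat n \<theta> * transpose_mat Q"
proof -
  let ?N = "2*n"
  define Q where "Q = mat ?N ?N (\<lambda>(i, r). u r $ i)"
  have Q: "Q \<in> carrier_mat ?N ?N" "transpose_mat Q \<in> carrier_mat ?N ?N" by (simp_all add: Q_def)
  have uc: "u r \<in> carrier_vec ?N" and uu: "s < ?N \<Longrightarrow> u r \<bullet> u s = of_bool (r = s)" if "r < ?N" for r s
    using fr that by (auto simp: rot_frame_def)
  have col: "col Q r = u r" if "r < ?N" for r
    using uc[OF that] that by (intro eq_vecI) (auto simp: Q_def)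
  have QQ: "transpose_mat Q * Q = 1\<^sub>m ?N"
    using Q col uu by (intro eq_matI) auto
  have QQ': "Q * transpose_mat Q = 1\<^sub>m ?N"
    by (rule mat_mult_left_right_inverse[OF Q(2,1) QQ])
  have AQ: "A * Q \<in> carrier_mat ?N ?N" using A Q by auto
  have "transpose_mat Q * (A * Q) = rot_mat n \<theta>"
  proof (rule eq_matI)
    fix r c assume "r < dim_row (rot_mat n \<theta>)" "c < dim_col (rot_mat n \<theta>)"
    then have rc: "r < ?N" "c < ?N" by (auto simp: rot_mat_def)
    have "col (A * Q) c = A *\<^sub>v u c" "row (transpose_mat Q) r = u r"
      using rc Q col by (simp_all add: col_mult2[OF A Q(1)])
    then have "(transpose_mat Q * (A * Q)) $$ (r, c) = u r \<bullet> (A *\<^sub>v u c)"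
      using rc A Q by (subst index_mult_mat) auto
    also have "\<dots> = rot_mat n \<theta> $$ (r, c)"
    proof -
      define i where "i = c div 2"
      have i: "i < n" and c: "c = 2*i \<or> c = 2*i+1" using rc by (auto simp: i_def)
      have e: "u r \<bullet> (a \<cdot>\<^sub>v u (2*i) + b \<cdot>\<^sub>v u (2*i+1)) = a * of_bool (r = 2*i) + b * of_bool (r = 2*i+1)" for a b
        using rc i uc uu by (subst scalar_prod_lincomb_right[of _ ?N]) auto
      have "A *\<^sub>v u (2*i) = cos (\<theta> i) \<cdot>\<^sub>v u (2*i) + sin (\<theta> i) \<cdot>\<^sub>v u (2*i+1)"
        "A *\<^sub>v u (2*i+1) = (- sin (\<theta> i)) \<cdot>\<^sub>v u (2*i) + cos (\<theta> i) \<cdot>\<^sub>v u (2*i+1)"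
        using fr i by (auto simp: rot_frame_def)
      note f = this[THEN arg_cong[of _ _ "(\<bullet>) (u r)"], unfolded e]
      have "r = 2 * (r div 2) \<or> r = 2 * (r div 2) + 1" by presburger
      then show ?thesis
        using c f rc i by (auto simp: rot_mat_def)
    qed
    finally show "(transpose_mat Q * (A * Q)) $$ (r, c) = rot_mat n \<theta> $$ (r, c)" .
  qed (use Q A in \<open>auto simp: rot_mat_def\<close>)
  then have "Q * rot_mat n \<theta> * transpose_mat Q = Q * (transpose_mat Q * (A * Q)) * transpose_mat Q"
    by simp
  also have "Q * (transpose_mat Q * (A * Q)) = (Q * transpose_mat Q) * (A * Q)"
    by (rule assoc_mult_mat[OF Q(1) Q(2) AQ, symmetric])
  also have "\<dots> = A * Q" unfolding QQ' by (rule left_mult_one_mat[OF AQ])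
  also have "A * Q * transpose_mat Q = A * (Q * transpose_mat Q)"
    by (rule assoc_mult_mat[OF A Q])
  also have "\<dots> = A" using QQ' A by simp
  finally show thesis
    using that[of Q] Q QQ QQ' by (simp add: orthogonal_group_def)
qed

text \<open>Reorders whole planes and keeps the order within each pair. This allows the frequencies
  to be sorted, so that the normal form depends on their multiset alone.\<close>

lemma rot_frame_permute:
  assumes fr: "rot_frame N A \<theta> u n" and p: "p permutes {..<n}"
  shows "rot_frame N A (\<theta> \<circ> p) (\<lambda>r. u (2 * p (r div 2) + r mod 2)) n"
proof -
  have pn: "p i < n" if "i < n" for i using permutes_in_image[OF p, of i] that by simp
  have lt: "2 * p (r div 2) + r mod 2 < 2 * n" if "r < 2 * n" for r
  proof -
    have "p (r div 2) < n" using that by (intro pn) simp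
    then show ?thesis by linarith
  qed
  have inj: "2 * p (r div 2) + r mod 2 = 2 * p (s div 2) + s mod 2 \<longleftrightarrow> r = s" for r s
  proof
    assume e: "2 * p (r div 2) + r mod 2 = 2 * p (s div 2) + s mod 2"
    then have "p (r div 2) = p (s div 2)" and 1: "r mod 2 = s mod 2" by presburger+
    then have "r div 2 = s div 2" using permutes_inj[OF p] by (simp add: inj_eq)
    with 1 show "r = s" by (metis div_mult_mod_eq)
  qed simp
  show ?thesis
    using fr pn lt by (simp add: rot_frame_def inj)
qed

section \<open>Conjugacy classes of the orthogonal group\<close>

lemma carrier_orthogonal_group:
  "A \<in> carrier (orthogonal_group N) \<longleftrightarrow>
    A \<in> carrier_mat N N \<and> transpose_mat A * A = 1\<^sub>m N \<and> A * transpose_mat A = 1\<^sub>m N"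
  by (auto simp: orthogonal_group_def)

lemma mult_orthogonal_group: "A \<otimes>\<^bsub>orthogonal_group N\<^esub> B = A * B"
  and one_orthogonal_group: "\<one>\<^bsub>orthogonal_group N\<^esub> = 1\<^sub>m N"
  by (simp_all add: orthogonal_group_def)

lemma inv_orthogonal_group:
  assumes "A \<in> carrier (orthogonal_group N)"
  shows "inv\<^bsub>orthogonal_group N\<^esub> A = transpose_mat A"
  using assms
  by (intro group.inv_equality[OF group_orthogonal_group])
    (auto simp: carrier_orthogonal_group mult_orthogonal_group one_orthogonal_group)

lemma pow_orthogonal_group:
  assumes "A \<in> carrier (orthogonal_group N)"
  shows "A [^]\<^bsub>orthogonal_group N\<^esub> (t::nat) = A ^\<^sub>m t"
proof -
  interpret G: group "orthogonal_group N" by (rule group_orthogonal_group)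
  show ?thesis
    by (induction t)
      (use assms in \<open>auto simp: one_orthogonal_group mult_orthogonal_group carrier_orthogonal_group\<close>)
qed

lemma rot_mat_orthogonal: "rot_mat n \<theta> \<in> carrier (orthogonal_group (2*n))"
  by (simp add: carrier_orthogonal_group rot_mat_transpose rot_mat_mult rot_mat_one)

lemma rot_mat_angle_pow:
  assumes "0 < m"
  shows "rot_mat n (\<lambda>i. angle m (js i)) ^\<^sub>m m = 1\<^sub>m (2*n)"
proof -
  have "cos (real m * angle m j) = 1" "sin (real m * angle m j) = 0" for j
  proof -
    have "real m * angle m j = 2 * real j * pi" using assms by (simp add: angle_def)
    then show "cos (real m * angle m j) = 1" "sin (real m * angle m j) = 0"
      by (simp_all only: cos_2npi sin_2npi)
  qed
  then have "rot_mat n (\<lambda>i. real m * angle m (js i)) = rot_mat n (\<lambda>_. 0)"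
    by (intro eq_matI) (auto simp: rot_mat_def)
  then show ?thesis by (simp only: rot_mat_pow rot_mat_one)
qed

lemma (in group) conj_nat_pow:
  assumes "g \<in> carrier G" "x \<in> carrier G"
  shows "(g \<otimes> x \<otimes> inv g) [^] (t::nat) = g \<otimes> x [^] t \<otimes> inv g"
proof (induction t)
  case 0
  then show ?case using assms by simp
next
  case (Suc t)
  have "inv g \<otimes> (g \<otimes> y) = y" if "y \<in> carrier G" for y
    using that assms by (simp flip: m_assoc)
  then show ?case using Suc assms by (simp add: m_assoc)
qed

lemma (in group_action) orbit_eq:
  assumes x: "x \<in> E" and y: "y \<in> orbit G \<phi> x"
  shows "orbit G \<phi> y = orbit G \<phi> x"
proof -
  have sub: "orbit G \<phi> z \<subseteq> E" if "z \<in> E" for z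
    using that element_image unfolding orbit_def by blast
  have yE: "y \<in> E" using sub[OF x] y by blast
  show ?thesis
    using sub[OF x] sub[OF yE] orbit_trans[OF x yE _ y] orbit_trans[OF yE x _ orbit_sym[OF x yE y]]
    by blast
qed

text \<open>Hence the classes contained in the set of solutions are exactly the classes of its
  elements.\<close>

lemma (in group) conj_orbit_subset_pow_one:
  assumes x: "x \<in> carrier G" "x [^] (t::nat) = \<one>"
  shows "orbit G (\<lambda>g. \<lambda>x \<in> carrier G. g \<otimes> x \<otimes> inv g) x \<subseteq> {y \<in> carrier G. y [^] t = \<one>}"
  using x by (auto simp: orbit_def conj_nat_pow)

lemma mem_conj_orbit_orthogonal_group:
  assumes "x \<in> carrier (orthogonal_group N)"
  shows "y \<in> orbit (orthogonal_group N) (\<lambda>g. \<lambda>x \<in> carrier (orthogonal_group N).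
      g \<otimes>\<^bsub>orthogonal_group N\<^esub> x \<otimes>\<^bsub>orthogonal_group N\<^esub> inv\<^bsub>orthogonal_group N\<^esub> g) x
    \<longleftrightarrow> (\<exists>Q\<in>carrier (orthogonal_group N). y = Q * x * transpose_mat Q)"
proof -
  have "y \<in> orbit (orthogonal_group N) (\<lambda>g. \<lambda>x \<in> carrier (orthogonal_group N).
      g \<otimes>\<^bsub>orthogonal_group N\<^esub> x \<otimes>\<^bsub>orthogonal_group N\<^esub> inv\<^bsub>orthogonal_group N\<^esub> g) x
    \<longleftrightarrow> (\<exists>Q\<in>carrier (orthogonal_group N).
      y = (\<lambda>x \<in> carrier (orthogonal_group N).
        Q \<otimes>\<^bsub>orthogonal_group N\<^esub> x \<otimes>\<^bsub>orthogonal_group N\<^esub> inv\<^bsub>orthogonal_group N\<^esub> Q) x)"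
    unfolding orbit_def by blast
  also have "\<dots> \<longleftrightarrow> (\<exists>Q\<in>carrier (orthogonal_group N). y = Q * x * transpose_mat Q)"
    using assms by (intro bex_cong refl) (simp add: mult_orthogonal_group inv_orthogonal_group)
  finally show ?thesis .
qed

lemma mat_trace_conj:
  assumes Q: "Q \<in> carrier (orthogonal_group N)" and X: "X \<in> carrier_mat N N"
  shows "mat_trace (Q * X * transpose_mat Q) = mat_trace X"
proof -
  have c: "Q \<in> carrier_mat N N" "transpose_mat Q \<in> carrier_mat N N" "transpose_mat Q * Q = 1\<^sub>m N"
    using Q by (auto simp: carrier_orthogonal_group)
  have "mat_trace (Q * X * transpose_mat Q) = mat_trace (transpose_mat Q * (Q * X))"
    using c X by (intro mat_trace_mult_comm[of _ N]) auto
  also have "transpose_mat Q * (Q * X) = (transpose_mat Q * Q) * X"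
    by (rule assoc_mult_mat[OF c(2,1) X, symmetric])
  also have "\<dots> = X" unfolding c(3) by (rule left_mult_one_mat[OF X])
  finally show ?thesis .
qed

text \<open>The power is taken inside the group, where it commutes with conjugation; then cyclicity
  of the trace applies.\<close>

lemma mat_trace_pow_conj:
  assumes Q: "Q \<in> carrier (orthogonal_group N)" and X: "X \<in> carrier (orthogonal_group N)"
  shows "mat_trace ((Q * X * transpose_mat Q) ^\<^sub>m t) = mat_trace (X ^\<^sub>m t)"
proof -
  interpret G: group "orthogonal_group N" by (rule group_orthogonal_group)
  let ?Y = "Q \<otimes>\<^bsub>orthogonal_group N\<^esub> X \<otimes>\<^bsub>orthogonal_group N\<^esub> inv\<^bsub>orthogonal_group N\<^esub> Q"
  have Y: "?Y = Q * X * transpose_mat Q"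
    using Q by (simp add: mult_orthogonal_group inv_orthogonal_group)
  have "?Y \<in> carrier (orthogonal_group N)" using Q X by simp
  then have "(Q * X * transpose_mat Q) ^\<^sub>m t = ?Y [^]\<^bsub>orthogonal_group N\<^esub> t"
    by (simp only: pow_orthogonal_group Y)
  also have "\<dots> = Q * X ^\<^sub>m t * transpose_mat Q"
    unfolding G.conj_nat_pow[OF Q X]
    using Q X by (simp add: mult_orthogonal_group inv_orthogonal_group pow_orthogonal_group)
  finally show ?thesis
    using X by (simp add: mat_trace_conj[OF Q] carrier_orthogonal_group)
qed

section \<open>Normal forms indexed by multisets of frequencies\<close>

lemma count_mset_eq_card_nth: "count (mset xs) l = card {i. i < length xs \<and> xs ! i = l}"
  by (simp add: count_mset count_list_eq_length_filter length_filter_conv_card eq_commute)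

lemma rot_mat_cong:
  assumes "\<And>i. i < n \<Longrightarrow> \<theta> i = \<phi> i"
  shows "rot_mat n \<theta> = rot_mat n \<phi>"
  using assms by (intro eq_matI) (auto simp: rot_mat_def)

text \<open>Sorting chooses one enumeration of the multiset. For \<open>size M = n\<close> the
  blocks \<open>i < n\<close> match the positions of the list exactly.\<close>

definition rot_mat_mset :: "nat \<Rightarrow> nat \<Rightarrow> nat multiset \<Rightarrow> real mat" where
  "rot_mat_mset m n M = rot_mat n (\<lambda>i. angle m (sorted_list_of_multiset M ! i))"

text \<open>By \<open>count_of_traces\<close>, the traces of the powers determine the multiplicity
  of each \<open>l \<le> k\<close> up to a known positive factor; beyond \<open>k\<close> all
  multiplicities are 0.\<close>

lemma rot_mat_mset_eq_of_traces:
  assumes m: "m = 2 * k + 1"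
    and M: "M \<in> multisets_of_size {..k} n" and M': "M' \<in> multisets_of_size {..k} n"
    and tr: "\<And>t. mat_trace (rot_mat_mset m n M ^\<^sub>m t) = mat_trace (rot_mat_mset m n M' ^\<^sub>m t)"
  shows "M = M'"
proof (rule multiset_eqI)
  fix l
  have len: "length (sorted_list_of_multiset L) = n"
    and le: "\<And>i. i < n \<Longrightarrow> sorted_list_of_multiset L ! i \<le> k"
    and cnt: "count L l = card {i. i < n \<and> sorted_list_of_multiset L ! i = l}"
    if L: "L \<in> multisets_of_size {..k} n" for L
  proof -
    have L': "set_mset L \<subseteq> {..k}" "size L = n"
      using L by (auto simp: multisets_of_size_def)
    have "size (mset (sorted_list_of_multiset L)) = n" using L' by simp
    then show len: "length (sorted_list_of_multiset L) = n" by (simp only: size_mset)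
    show "sorted_list_of_multiset L ! i \<le> k" if i: "i < n" for i
    proof -
      have "sorted_list_of_multiset L ! i \<in> set (sorted_list_of_multiset L)"
        using i len by (intro nth_mem) simp
      then show ?thesis using L' by auto
    qed
    show "count L l = card {i. i < n \<and> sorted_list_of_multiset L ! i = l}"
      using count_mset_eq_card_nth[of "sorted_list_of_multiset L" l]
      unfolding len mset_sorted_list_of_multiset .
  qed
  show "count M l = count M' l"
  proof (cases "l \<le> k")
    case True
    let ?T = "\<lambda>L. \<Sum>t<m. cos (angle m l * real t) * mat_trace (rot_mat_mset m n L ^\<^sub>m t)"
    have T: "?T L = (if l = 0 then 2 * real m else real m) * real (count L l)"
      if "L \<in> multisets_of_size {..k} n" for L
      unfolding cnt[OF that] rot_mat_mset_def by (rule count_of_traces[OF m le[OF that] True])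
    have "?T M = ?T M'" by (simp only: tr)
    then have "(if l = 0 then 2 * real m else real m) * real (count M l)
        = (if l = 0 then 2 * real m else real m) * real (count M' l)"
      unfolding T[OF M] T[OF M'] .
    then show ?thesis using m by (auto split: if_splits)
  next
    case False
    then have "l \<notin># M" "l \<notin># M'" using M M' by (auto simp: multisets_of_size_def)
    then show ?thesis by (simp add: not_in_iff)
  qed
qed

text \<open>The greedy frame lists its frequencies in order of discovery. A permutation of the
  planes sorts them before the frame is turned into a conjugating matrix.\<close>

lemma orthogonal_conj_rot_mat_mset:
  assumes A: "A \<in> carrier (orthogonal_group (2*n))" and per: "A ^\<^sub>m m = 1\<^sub>m (2*n)"
    and m: "m = 2 * k + 1"
  obtains M Q where "M \<in> multisets_of_size {..k} n" "Q \<in> carrier (orthogonal_group (2*n))"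
    "A = Q * rot_mat_mset m n M * transpose_mat Q"
proof -
  interpret isometry "2*n" A
    using A by unfold_locales (auto simp: carrier_orthogonal_group)
  obtain js u where js: "\<And>i. js i \<le> k" and fr: "rot_frame (2*n) A (\<lambda>i. angle m (js i)) u n"
    using exists_rot_frame[OF per m, of n] by auto
  define xs where "xs = map js [0..<n]"
  define ys where "ys = sorted_list_of_multiset (mset xs)"
  have "mset ys = mset xs" by (simp add: ys_def)
  \<comment> \<open>A list and its sorted version have the same multiset, so a permutation of
    positions relates them.\<close>
  then obtain p where p: "p permutes {..<length xs}" "permute_list p xs = ys"
    by (rule mset_eq_permutation)
  have p': "p permutes {..<n}" using p by (simp add: xs_def)
  have "ys ! i = js (p i)" if "i < n" for i
    using that p permutes_in_image[OF p', of i]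
    by (auto simp: permute_list_def xs_def)
  then have eq: "rot_mat n ((\<lambda>i. angle m (js i)) \<circ> p) = rot_mat_mset m n (mset xs)"
    unfolding rot_mat_mset_def ys_def[symmetric] by (intro rot_mat_cong) simp
  obtain Q where "Q \<in> carrier (orthogonal_group (2*n))"
    "A = Q * rot_mat n ((\<lambda>i. angle m (js i)) \<circ> p) * transpose_mat Q"
    using conj_of_rot_frame[OF _ rot_frame_permute[OF fr p']] A
    by (auto simp: carrier_orthogonal_group)
  moreover have "mset xs \<in> multisets_of_size {..k} n"
    using js by (auto simp: multisets_of_size_def xs_def)
  ultimately show thesis using that eq by metis
qed

theorem theorem11:
  fixes n m k :: nat
  assumes "0 < n" and "m = 2 * k + 1"
  shows "num_conjugacy_classes (orthogonal_group (2 * n)) m = (n + m div 2) choose (m div 2)"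
proof -
  let ?G = "orthogonal_group (2 * n)"
  let ?\<phi> = "\<lambda>g. \<lambda>x \<in> carrier ?G. g \<otimes>\<^bsub>?G\<^esub> x \<otimes>\<^bsub>?G\<^esub> inv\<^bsub>?G\<^esub> g"
  let ?S = "{C \<in> conjugacy_classes ?G. C \<subseteq> {x \<in> carrier ?G. x [^]\<^bsub>?G\<^esub> m = \<one>\<^bsub>?G\<^esub>}}"
  let ?F = "\<lambda>M. orbit ?G ?\<phi> (rot_mat_mset m n M)"
  interpret G: group ?G by (rule group_orthogonal_group)
  interpret conj: group_action ?G "carrier ?G" ?\<phi> by (rule G.action_by_conjugation)
  note m = assms(2)
  have R: "rot_mat_mset m n M \<in> carrier ?G" for M
    unfolding rot_mat_mset_def by (rule rot_mat_orthogonal)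
  have Rm: "rot_mat_mset m n M [^]\<^bsub>?G\<^esub> m = \<one>\<^bsub>?G\<^esub>" for M
    unfolding pow_orthogonal_group[OF R] one_orthogonal_group
    unfolding rot_mat_mset_def by (rule rot_mat_angle_pow) (simp add: m)
  note orb = mem_conj_orbit_orthogonal_group[OF R]
  \<comment> \<open>Each multiset of \<open>n\<close> frequencies is sent to the class of its normal
    form. Traces give injectivity, and the normal form of an orthogonal matrix gives
    surjectivity.\<close>
  have "bij_betw ?F (multisets_of_size {..k} n) ?S"
  proof (rule bij_betwI')
    fix M M' assume M: "M \<in> multisets_of_size {..k} n" "M' \<in> multisets_of_size {..k} n"
    show "?F M = ?F M' \<longleftrightarrow> M = M'"
    proof
      assume "?F M = ?F M'"
      then have "rot_mat_mset m n M' \<in> ?F M" using conj.orbit_refl[OF R] by blast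
      then obtain Q where Q: "Q \<in> carrier ?G"
        "rot_mat_mset m n M' = Q * rot_mat_mset m n M * transpose_mat Q"
        unfolding orb by blast
      show "M = M'"
        by (rule rot_mat_mset_eq_of_traces[OF m M]) (simp only: Q(2) mat_trace_pow_conj[OF Q(1) R])
    qed simp
  next
    fix M assume "M \<in> multisets_of_size {..k} n"
    show "?F M \<in> ?S"
      using R G.conj_orbit_subset_pow_one[OF R Rm]
      unfolding conjugacy_classes_def orbits_def by blast
  next
    fix C assume C: "C \<in> ?S"
    then obtain A where A: "A \<in> carrier ?G" "C = orbit ?G ?\<phi> A"
      unfolding conjugacy_classes_def orbits_def by blast
    have "A \<in> C" unfolding A(2) by (rule conj.orbit_refl[OF A(1)])
    then have "A [^]\<^bsub>?G\<^esub> m = \<one>\<^bsub>?G\<^esub>" using C by blast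
    then have "A ^\<^sub>m m = 1\<^sub>m (2*n)"
      unfolding pow_orthogonal_group[OF A(1)] one_orthogonal_group .
    then obtain M Q where M: "M \<in> multisets_of_size {..k} n" "Q \<in> carrier ?G"
      "A = Q * rot_mat_mset m n M * transpose_mat Q"
      using orthogonal_conj_rot_mat_mset[OF A(1) _ m] by blast
    \<comment> \<open>Orbits sharing an element coincide, so it suffices that \<open>A\<close> lies
      in the orbit of its normal form.\<close>
    then have "A \<in> ?F M" unfolding orb by blast
    then show "\<exists>M\<in>multisets_of_size {..k} n. C = ?F M"
      using conj.orbit_eq[OF R] A M by blast
  qed
  then have "card ?S = card (multisets_of_size {..k} n)"
    by (simp only: bij_betw_same_card)
  \<comment> \<open>Stars and bars: \<open>{..k}\<close> has \<open>k + 1\<close> elements. Finally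
    \<open>k\<close> is \<open>m div 2\<close>.\<close>
  also have "\<dots> = (n + k) choose n"
    by (simp add: card_multisets_of_size add.commute)
  also have "\<dots> = (n + k) choose k"
    using binomial_symmetric[of n "n + k"] by simp
  finally show ?thesis
    using m by (simp add: num_conjugacy_classes_def)
qed

end
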